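(* Let $r\in\mathbb{N}$ and $n\in\mathbb{Z}_+$. Define $$E_{n,w,q}^{(r)}=\int_{\mathbb{Z}_p^r} w^{x_1+\cdots+x_r}\,[x_1+\cdots+x_r]_q^n\,d\mu_{-1}(x_1)\cdots d\mu_{-1}(x_r).$$ Then $$E_{n,w,q}^{(r)}=2^r\sum_{m=0}^{\infty}\binom{m+r-1}{m}(-1)^m w^m [m]_q^n .$$
   Context: Let $p$ be a fixed odd prime, $\mathbb{Z}_p$ the ring of $p$-adic integers, $\mathbb{C}_p$ the completion of the algebraic closure of $\mathbb{Q}_p$, with normalized absolute value $|p|_p=1/p$, and $\mathbb{Z}_+=\mathbb{N}\cup\{0\}$. Let $q,w\in\mathbb{C}_p$ with $|1-q|_p<1$ and $|1-w|_p<1$. For $x\in\mathbb{Z}_p$ put $[x]_q=\frac{1-q^x}{1-q}$. For a uniformly differentiable function $f:\mathbb{Z}_p\to\mathbb{C}_p$, the fermionic $p$-adic integral is $\int_{\mathbb{Z}_p}f(x)\,d\mu_{-1}(x)=\lim_{N\to\infty}\sum_{x=0}^{p^N-1}f(x)(-1)^x$, and $\int_{\mathbb{Z}_p^r}\cdots d\mu_{-1}(x_1)\cdots d\mu_{-1}(x_r)$ denotes the $r$-fold iterated fermionic integral.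
   Formalization: The infinite series never converges in C_p (e.g. r=1, n=0, w=1 gives 2Σ(-1)^m), so its sum is read as the value at t=1 of the rational function whose power series is Σ C(m+r-1,m)(-1)^m w^m [m]_q^n t^m; at q=1, [x]_q is taken to be x. *)

theory Defs
  imports "HOL-Analysis.Analysis" "HOL-Computational_Algebra.Polynomial_FPS"
begin

text \<open>
  The field of \<open>p\<close>-adic complex numbers, up to isometric isomorphism: a complete field with an
  ultrametric absolute value normalized by \<open>\<bar>p\<bar> = 1/p\<close>.  The closure of the rationals is
  \<open>\<rat>\<^sub>p\<close> (on the rationals the absolute value is forced to be the \<open>p\<close>-adic one), the elements
  algebraic over \<open>\<rat>\<^sub>p\<close> form an algebraic closure of it, and this algebraic closure is dense.
\<close>

definition Qp :: "'a::{field_char_0, complete_space} set" where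
  "Qp = closure \<rat>"

definition Qp_alg :: "'a::{field_char_0, complete_space} set" where
  "Qp_alg = {x. \<exists>f. f \<noteq> 0 \<and> (\<forall>i. coeff f i \<in> Qp) \<and> poly f x = 0}"

locale padic_complex_field =
  fixes p :: nat
    and v :: "'a::{field_char_0, complete_space} \<Rightarrow> real"
  assumes prime_p: "prime p"
    and dist_eq: "dist x y = v (x - y)"
    and v_mult: "v (x * y) = v x * v y"
    and v_ultra: "v (x + y) \<le> max (v x) (v y)"
    and v_p: "v (of_nat p) = 1 / real p"
    and Qp_alg_closed:
      "\<lbrakk>degree (f :: 'a poly) > 0; \<forall>i. coeff f i \<in> Qp_alg\<rbrakk> \<Longrightarrow> \<exists>x\<in>Qp_alg. poly f x = 0"
    and Qp_alg_dense: "closure Qp_alg = (UNIV :: 'a set)"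

text \<open>
  \<open>q\<^sup>x\<close> for \<open>x \<in> \<int>\<^sub>p\<close> and \<open>\<bar>1 - q\<bar> < 1\<close>, as the binomial series of \<open>(1 + (q - 1))\<^sup>x\<close>; this is
  the continuous extension to \<open>\<int>\<^sub>p\<close> of the power function on the naturals.
\<close>

definition padic_power :: "'a::{field_char_0, complete_space} \<Rightarrow> 'a \<Rightarrow> 'a" where
  "padic_power q x = (\<Sum>k. (x gchoose k) * (q - 1) ^ k)"

lemma padic_power_of_nat: "padic_power q (of_nat n) = q ^ n"
proof -
  have "padic_power q (of_nat n) = (\<Sum>k\<le>n. (of_nat n gchoose k) * (q - 1) ^ k)"
    unfolding padic_power_def
    by (rule suminf_finite) (auto simp: binomial_gbinomial [symmetric] binomial_eq_0)
  also have "\<dots> = (\<Sum>k\<le>n. of_nat (n choose k) * (q - 1) ^ k * 1 ^ (n - k))"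
    by (simp add: binomial_gbinomial)
  also have "\<dots> = q ^ n"
    using binomial_ring [of "q - 1" 1 n] by simp
  finally show ?thesis .
qed

text \<open>At \<open>q = 1\<close>, where the quotient is \<open>0/0\<close>, the value is the limit \<open>x\<close> for \<open>q \<rightarrow> 1\<close>.\<close>

definition q_number :: "'a::{field_char_0, complete_space} \<Rightarrow> 'a \<Rightarrow> 'a" where
  "q_number q x = (if q = 1 then x else (1 - padic_power q x) / (1 - q))"

definition fermionic_integral ::
    "nat \<Rightarrow> ('a::{field_char_0, complete_space} \<Rightarrow> 'a) \<Rightarrow> 'a" where
  "fermionic_integral p f = lim (\<lambda>N. \<Sum>x<p ^ N. f (of_nat x) * (-1) ^ x)"

text \<open>The integrand takes the list \<open>[x\<^sub>1, \<dots>, x\<^sub>r]\<close> of the \<open>r\<close> integration variables.\<close>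

fun iterated_fermionic_integral ::
    "nat \<Rightarrow> nat \<Rightarrow> ('a::{field_char_0, complete_space} list \<Rightarrow> 'a) \<Rightarrow> 'a" where
  "iterated_fermionic_integral p 0 f = f []"
| "iterated_fermionic_integral p (Suc r) f =
     fermionic_integral p (\<lambda>x. iterated_fermionic_integral p r (\<lambda>xs. f (x # xs)))"

definition q_euler_number ::
    "nat \<Rightarrow> nat \<Rightarrow> nat \<Rightarrow> 'a::{field_char_0, complete_space} \<Rightarrow> 'a \<Rightarrow> 'a" where
  "q_euler_number p r n w q =
     iterated_fermionic_integral p r
       (\<lambda>xs. padic_power w (sum_list xs) * q_number q (sum_list xs) ^ n)"

text \<open>
  A series such as \<open>\<Sum>m. (-1)\<^sup>m w\<^sup>m\<close> with \<open>\<bar>1 - w\<bar> < 1\<close> has terms of absolute value 1 and so does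
  not converge; its value \<open>1 / (1 + w)\<close> comes from the expansion of a rational function.
  Accordingly, the sum of \<open>a\<close> is \<open>R(1)\<close>, where \<open>R = P / Q\<close> is the rational function, without
  pole at 1, whose power series expansion at 0 is \<open>\<Sum>m. a m t\<^sup>m\<close>.  The value does not depend
  on \<open>P\<close> and \<open>Q\<close>, and it is the ordinary sum if the series converges.
\<close>

definition rational_sums :: "(nat \<Rightarrow> 'a::field) \<Rightarrow> 'a \<Rightarrow> bool" where
  "rational_sums a s \<longleftrightarrow>
     (\<exists>P Q. poly Q 1 \<noteq> 0 \<and> Abs_fps a * fps_of_poly Q = fps_of_poly P \<and> s = poly P 1 / poly Q 1)"

lemma rational_sums_unique:
  assumes "rational_sums a s" "rational_sums a s'"
  shows "s = s'"
proof -
  obtain P Q where PQ: "poly Q 1 \<noteq> 0" "Abs_fps a * fps_of_poly Q = fps_of_poly P"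
      "s = poly P 1 / poly Q 1"
    using assms(1) unfolding rational_sums_def by blast
  obtain P' Q' where PQ': "poly Q' 1 \<noteq> 0" "Abs_fps a * fps_of_poly Q' = fps_of_poly P'"
      "s' = poly P' 1 / poly Q' 1"
    using assms(2) unfolding rational_sums_def by blast
  have "fps_of_poly (P * Q') = fps_of_poly (P' * Q)"
    unfolding fps_of_poly_mult PQ(2) [symmetric] PQ'(2) [symmetric] by (simp add: mult_ac)
  then have "P * Q' = P' * Q"
    by (simp add: fps_of_poly_eq_iff)
  then have "poly P 1 * poly Q' 1 = poly P' 1 * poly Q 1"
    by (metis poly_mult)
  then show ?thesis
    using PQ PQ' by (simp add: frac_eq_eq)
qed

context padic_complex_field
begin

lemma v_tendsto_iff: "X \<longlonglongrightarrow> L \<longleftrightarrow> (\<lambda>n. v (X n - L)) \<longlonglongrightarrow> 0"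
  by (subst tendsto_dist_iff) (simp add: dist_eq)

lemma v_nonneg: "v x \<ge> 0"
  using dist_eq [of x 0] zero_le_dist [of x 0] by simp

lemma v_tendsto_add:
  fixes X Y :: "nat \<Rightarrow> 'a"
  assumes "X \<longlonglongrightarrow> L" "Y \<longlonglongrightarrow> M"
  shows "(\<lambda>n. X n + Y n) \<longlonglongrightarrow> L + M"
proof -
  have lim: "(\<lambda>n. max (v (X n - L)) (v (Y n - M))) \<longlonglongrightarrow> 0"
    using tendsto_max [OF assms [unfolded v_tendsto_iff]] by simp
  have le: "v (X n + Y n - (L + M)) \<le> max (v (X n - L)) (v (Y n - M))" for n
    using v_ultra [of "X n - L" "Y n - M"] by (simp only: add_diff_add)
  have "(\<lambda>n. v (X n + Y n - (L + M))) \<longlonglongrightarrow> 0"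
    by (rule tendsto_sandwich [OF _ _ tendsto_const lim]) (simp_all only: le v_nonneg eventually_True)
  then show ?thesis
    by (simp only: v_tendsto_iff)
qed

lemma v_tendsto_mult_left:
  fixes X :: "nat \<Rightarrow> 'a"
  assumes "X \<longlonglongrightarrow> L"
  shows "(\<lambda>n. c * X n) \<longlonglongrightarrow> c * L"
proof -
  have "(\<lambda>n. v c * v (X n - L)) \<longlonglongrightarrow> v c * 0"
    using assms by (intro tendsto_mult tendsto_const) (simp add: v_tendsto_iff)
  then show ?thesis
    unfolding v_tendsto_iff by (simp add: v_mult [symmetric] right_diff_distrib)
qed

lemma sums_fps_mult_poly:
  fixes a :: "nat \<Rightarrow> 'a"
  assumes "a sums s"
  shows "fps_nth (Abs_fps a * fps_of_poly Q) sums (s * poly Q 1)"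
proof (induction Q)
  case 0
  then show ?case by simp
next
  case (pCons c Q)
  define B where "B = Abs_fps a * fps_of_poly Q"
  have eq: "Abs_fps a * fps_of_poly (pCons c Q) = fps_const c * Abs_fps a + fps_X * B"
    unfolding B_def fps_of_poly_pCons by (simp only: distrib_left mult_ac)
  have shift: "(\<Sum>k<Suc n. fps_nth (fps_X * B) k) = (\<Sum>k<n. fps_nth B k)" for n
    by (subst sum.lessThan_Suc_shift) simp
  have "(\<lambda>n. \<Sum>k<Suc n. fps_nth (fps_X * B) k) \<longlonglongrightarrow> s * poly Q 1"
    using pCons.IH unfolding shift by (simp add: sums_def B_def)
  then have "(\<lambda>n. \<Sum>k<n. fps_nth (fps_X * B) k) \<longlonglongrightarrow> s * poly Q 1"
    by (rule LIMSEQ_imp_Suc)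
  moreover have "(\<lambda>n. c * (\<Sum>k<n. a k)) \<longlonglongrightarrow> c * s"
    using assms by (intro v_tendsto_mult_left) (simp add: sums_def)
  ultimately have "(\<lambda>n. c * (\<Sum>k<n. a k) + (\<Sum>k<n. fps_nth (fps_X * B) k))
      \<longlonglongrightarrow> c * s + s * poly Q 1"
    by (intro v_tendsto_add)
  then show ?case
    unfolding eq sums_def by (simp add: sum.distrib sum_distrib_left distrib_left mult.commute)
qed

lemma rational_sums_eq_sums:
  fixes a :: "nat \<Rightarrow> 'a"
  assumes "rational_sums a s" "a sums t"
  shows "s = t"
proof -
  obtain P Q where PQ: "poly Q 1 \<noteq> 0" "Abs_fps a * fps_of_poly Q = fps_of_poly P"
      "s = poly P 1 / poly Q 1"
    using assms(1) unfolding rational_sums_def by blast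
  have "coeff P sums (\<Sum>i\<le>degree P. coeff P i)"
    by (rule sums_finite) (auto simp: coeff_eq_0)
  moreover have "fps_nth (fps_of_poly P) = coeff P"
    by (simp add: fun_eq_iff)
  then have "coeff P sums (t * poly Q 1)"
    using sums_fps_mult_poly [OF assms(2), of Q] by (simp only: PQ(2))
  ultimately have "poly P 1 = t * poly Q 1"
    by (simp add: poly_altdef sums_unique2)
  then show ?thesis
    using PQ by simp
qed

end

end

theory Submission
  imports Defs
begin

text \<open>
  Let \<open>W\<close> be the space of sequences spanned by \<open>m \<mapsto> u\<^sup>m m\<^sup>k\<close> with \<open>\<bar>1 - u\<bar> < 1\<close>, and let \<open>E\<close> be
  the shift.  On \<open>W\<close> the operator \<open>1 + E\<close> is surjective, because \<open>1 + u \<noteq> 0\<close> for odd \<open>p\<close>.  If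
  \<open>(1 + E) h = 2 g\<close> in \<open>W\<close>, then the alternating sum of \<open>g (s + x)\<close> over \<open>x < p\<^sup>N\<close> telescopes to
  \<open>(h s + h (s + p\<^sup>N)) / 2\<close>, which tends to \<open>h s\<close>; so integration over one variable is the
  operator \<open>2 (1 + E)\<^sup>-\<^sup>1\<close>.  On the side of the series, Pascal's rule shows that substituting
  \<open>g = (h + E h) / 2\<close> into \<open>\<Sum>m. (m + r choose m) (-1)\<^sup>m g m\<close> halves the sum and lowers \<open>r\<close>
  by one, so that both sides obey the same recursion.
\<close>

section \<open>Sums of expansions of rational functions\<close>

lemma rational_sums_add:
  assumes "rational_sums a s" "rational_sums b t"
  shows "rational_sums (\<lambda>m. a m + b m) (s + t)"
proof -
  obtain P Q where PQ: "poly Q 1 \<noteq> 0" "Abs_fps a * fps_of_poly Q = fps_of_poly P"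
      "s = poly P 1 / poly Q 1"
    using assms(1) unfolding rational_sums_def by blast
  obtain P' Q' where PQ': "poly Q' 1 \<noteq> 0" "Abs_fps b * fps_of_poly Q' = fps_of_poly P'"
      "t = poly P' 1 / poly Q' 1"
    using assms(2) unfolding rational_sums_def by blast
  have ab: "Abs_fps (\<lambda>m. a m + b m) = Abs_fps a + Abs_fps b"
    by (simp add: fps_eq_iff)
  have "Abs_fps (\<lambda>m. a m + b m) * fps_of_poly (Q * Q') = fps_of_poly (P * Q' + P' * Q)"
    unfolding fps_of_poly_mult fps_of_poly_add PQ(2) [symmetric] PQ'(2) [symmetric] ab
    by (simp add: algebra_simps)
  moreover have "s + t = poly (P * Q' + P' * Q) 1 / poly (Q * Q') 1"
    using PQ PQ' by (simp add: add_frac_eq)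
  moreover have "poly (Q * Q') 1 \<noteq> 0"
    using PQ PQ' by simp
  ultimately show ?thesis
    unfolding rational_sums_def by blast
qed

lemma rational_sums_cmult:
  assumes "rational_sums a s"
  shows "rational_sums (\<lambda>m. c * a m) (c * s)"
proof -
  obtain P Q where PQ: "poly Q 1 \<noteq> 0" "Abs_fps a * fps_of_poly Q = fps_of_poly P"
      "s = poly P 1 / poly Q 1"
    using assms unfolding rational_sums_def by blast
  have "Abs_fps (\<lambda>m. c * a m) = fps_const c * Abs_fps a"
    by (simp add: fps_eq_iff)
  then have "Abs_fps (\<lambda>m. c * a m) * fps_of_poly Q = fps_of_poly (smult c P)"
    by (simp add: fps_of_poly_smult PQ(2) [symmetric] mult.assoc)
  moreover have "c * s = poly (smult c P) 1 / poly Q 1"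
    using PQ by simp
  ultimately show ?thesis
    unfolding rational_sums_def using PQ(1) by blast
qed

lemma rational_sums_diff:
  assumes "rational_sums a s" "rational_sums b t"
  shows "rational_sums (\<lambda>m. a m - b m) (s - t)"
  using rational_sums_add [OF assms(1) rational_sums_cmult [OF assms(2), of "-1"]] by simp

text \<open>If F = a 0 + t G and F = P / Q, then G = (P - a 0 Q) / (t Q). The new factor t equals 1
  at t = 1, so no pole appears there.\<close>

lemma rational_sums_Suc:
  assumes "rational_sums a s"
  shows "rational_sums (\<lambda>m. a (Suc m)) (s - a 0)"
proof -
  obtain P Q where PQ: "poly Q 1 \<noteq> 0" "Abs_fps a * fps_of_poly Q = fps_of_poly P"
      "s = poly P 1 / poly Q 1"
    using assms unfolding rational_sums_def by blast
  have a: "Abs_fps a = fps_const (a 0) + fps_X * Abs_fps (\<lambda>m. a (Suc m))"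
    by (auto simp: fps_eq_iff gr0_conv_Suc split: nat.split)
  have "Abs_fps (\<lambda>m. a (Suc m)) * fps_of_poly (pCons 0 Q) = fps_of_poly (P - smult (a 0) Q)"
    unfolding fps_of_poly_diff fps_of_poly_smult fps_of_poly_pCons PQ(2) [symmetric]
    by (subst a) (simp add: algebra_simps)
  moreover have "s - a 0 = poly (P - smult (a 0) Q) 1 / poly (pCons 0 Q) 1"
    using PQ by (simp add: field_simps)
  moreover have "poly (pCons 0 Q) 1 \<noteq> 0"
    using PQ by simp
  ultimately show ?thesis
    unfolding rational_sums_def by blast
qed

lemma rational_sums_geometric:
  assumes "u \<noteq> 1"
  shows "rational_sums (\<lambda>m. u ^ m) (1 / (1 - u))"
proof -
  have "Abs_fps (\<lambda>m. u ^ m) * fps_of_poly [:1, -u:] = 1"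
  proof (rule fps_ext)
    fix n
    have "Abs_fps (\<lambda>m. u ^ m) * fps_of_poly [:1, -u:]
        = Abs_fps (\<lambda>m. u ^ m) - fps_const u * (fps_X * Abs_fps (\<lambda>m. u ^ m))"
      by (simp add: fps_of_poly_pCons algebra_simps flip: fps_const_neg)
    then show "fps_nth (Abs_fps (\<lambda>m. u ^ m) * fps_of_poly [:1, -u:]) n = fps_nth 1 n"
      by (cases n) simp_all
  qed
  then have "Abs_fps (\<lambda>m. u ^ m) * fps_of_poly [:1, -u:] = fps_of_poly 1"
    by simp
  moreover have "poly [:1, -u:] 1 \<noteq> 0" "1 / (1 - u) = poly 1 1 / poly [:1, -u:] 1"
    using assms by simp_all
  ultimately show ?thesis
    unfolding rational_sums_def by blast
qed

section \<open>Weights polynomial in the index\<close>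

lemma rational_summable_of_nat_mult:
  assumes "rational_sums a s"
  shows "\<exists>t. rational_sums (\<lambda>m. of_nat m * a m) t"
proof -
  obtain P Q where PQ: "poly Q 1 \<noteq> 0" "Abs_fps a * fps_of_poly Q = fps_of_poly P"
    using assms unfolding rational_sums_def by blast
  define F where "F = Abs_fps a"
  \<comment> \<open>Multiplying coefficients by m is t d/dt. By the quotient rule the derivative of
    P / Q has denominator Q^2, again nonzero at 1.\<close>
  have F: "Abs_fps (\<lambda>m. of_nat m * a m) = fps_X * fps_deriv F"
    by (auto simp: fps_eq_iff F_def gr0_conv_Suc)
  have deriv: "fps_deriv F * fps_of_poly Q + F * fps_of_poly (pderiv Q) = fps_of_poly (pderiv P)"
    using arg_cong [OF PQ(2), of fps_deriv]
    by (simp add: F_def fps_of_poly_pderiv algebra_simps)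
  have "fps_deriv F * fps_of_poly (Q * Q) = fps_of_poly (pderiv P * Q - P * pderiv Q)"
    unfolding fps_of_poly_mult fps_of_poly_diff deriv [symmetric] PQ(2) [symmetric]
    by (simp add: F_def algebra_simps)
  then have "Abs_fps (\<lambda>m. of_nat m * a m) * fps_of_poly (Q * Q)
      = fps_of_poly (pCons 0 (pderiv P * Q - P * pderiv Q))"
    by (simp only: F fps_of_poly_pCons mult.assoc) (simp add: mult_ac)
  moreover have "poly (Q * Q) 1 \<noteq> 0"
    using PQ by simp
  ultimately show ?thesis
    unfolding rational_sums_def by blast
qed

lemma rational_summable_of_nat_power_mult:
  assumes "rational_sums a s"
  shows "\<exists>t. rational_sums (\<lambda>m. of_nat m ^ k * a m) t"
proof (induction k)
  case 0
  then show ?case using assms by auto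
next
  case (Suc k)
  then obtain t where "rational_sums (\<lambda>m. of_nat m ^ k * a m) t"
    by blast
  from rational_summable_of_nat_mult [OF this] show ?case
    by (simp add: mult.assoc)
qed

text \<open>The binomial weight is a polynomial in m: raising r by one multiplies it by (m + r + 1)
  / (r + 1).\<close>

lemma rational_summable_binomial_mult:
  fixes a :: "nat \<Rightarrow> 'a::field_char_0"
  assumes "rational_sums a s"
  shows "\<exists>t. rational_sums (\<lambda>m. of_nat ((m + r) choose m) * a m) t"
proof (induction r)
  case 0
  then show ?case using assms by auto
next
  case (Suc r)
  define b where "b = (\<lambda>m. of_nat ((m + r) choose m) * a m)"
  obtain t where t: "rational_sums b t"
    using Suc unfolding b_def by blast
  obtain t' where t': "rational_sums (\<lambda>m. of_nat m * b m) t'"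
    using rational_summable_of_nat_mult [OF t] by blast
  have "of_nat ((m + Suc r) choose m) * a m
      = 1 / of_nat (Suc r) * (of_nat m * b m + of_nat (Suc r) * b m)" for m
  proof -
    have "Suc r * ((m + Suc r) choose m) = (m + Suc r) * ((m + r) choose m)"
      using Suc_times_binomial_eq [of "m + r" r] binomial_symmetric [of m "m + r"]
        binomial_symmetric [of m "m + Suc r"] by (simp add: mult.commute)
    then have "of_nat (Suc r) * of_nat ((m + Suc r) choose m)
        = (of_nat m + of_nat (Suc r)) * (of_nat ((m + r) choose m) :: 'a)"
      by (metis of_nat_add of_nat_mult)
    then show ?thesis
      unfolding b_def
      by (simp add: field_simps del: of_nat_Suc binomial_Suc_Suc add_Suc_right)
  qed
  then show ?case
    using rational_sums_cmult [OF rational_sums_add [OF t' rational_sums_cmult [OF t]]]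
    by (simp only:) blast
qed

section \<open>The absolute value\<close>

context padic_complex_field
begin

lemma v_0 [simp]: "v 0 = 0"
  using dist_eq [of 0 0] by simp

lemma v_eq_0_iff [simp]: "v x = 0 \<longleftrightarrow> x = 0"
  using dist_eq [of x 0] dist_eq_0_iff [of x 0] by simp

lemma v_1 [simp]: "v 1 = 1"
  using v_mult [of 1 1] by simp

lemma v_minus [simp]: "v (- x) = v x"
  using dist_eq [of x 0] dist_eq [of 0 x] dist_commute [of x 0] by simp

lemma v_diff_commute: "v (x - y) = v (y - x)"
  using v_minus [of "x - y"] by simp

lemma v_of_nat_le_1: "v (of_nat n) \<le> 1"
proof (induction n)
  case (Suc n)
  then show ?case using v_ultra [of 1 "of_nat n"] by simp
qed simp

lemma v_sum_le:
  assumes "\<And>i. i \<in> A \<Longrightarrow> v (f i) \<le> B" "0 \<le> B"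
  shows "v (sum f A) \<le> B"
  using assms
proof (induction A rule: infinite_finite_induct)
  case (insert i A)
  then show ?case using v_ultra [of "f i" "sum f A"] by fastforce
qed auto

lemma v_le_1_of_near_1:
  assumes "v (1 - u) < 1"
  shows "v u \<le> 1"
  using v_ultra [of 1 "u - 1"] assms v_diff_commute [of u 1] by simp

lemma near_1_mult:
  assumes "v (1 - u) < 1" "v (1 - q) < 1"
  shows "v (1 - u * q) < 1"
proof -
  have "v (u * (1 - q)) < 1"
    using mult_left_le_one_le [OF v_nonneg v_nonneg v_le_1_of_near_1 [OF assms(1)], of "1 - q"]
      assms(2) by (simp add: v_mult)
  then show ?thesis
    using v_ultra [of "1 - u" "u * (1 - q)"] assms(1) by (simp add: algebra_simps)
qed

section \<open>Limits along powers of p\<close>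

lemma near_1_power_le:
  assumes "v (1 - u) < 1"
  shows "v (u ^ i - 1) \<le> v (u - 1)"
proof (induction i)
  case 0
  then show ?case by (simp add: v_nonneg)
next
  case (Suc i)
  have "v (u * (u ^ i - 1)) \<le> v (u ^ i - 1)"
    unfolding v_mult using v_le_1_of_near_1 [OF assms] by (simp add: mult_left_le_one_le v_nonneg)
  then show ?case
    using v_ultra [of "u * (u ^ i - 1)" "u - 1"] Suc by (simp add: algebra_simps)
qed

text \<open>Factor u^p - 1 as u - 1 times the sum of u^i over i < p. That sum is p plus the terms
  u^i - 1, hence small.\<close>

lemma near_1_p_power_le:
  assumes "v (1 - u) < 1"
  shows "v (u ^ p - 1) \<le> v (u - 1) * max (1 / real p) (v (u - 1))"
proof -
  have "v (\<Sum>i<p. u ^ i - 1) \<le> v (u - 1)"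
    by (rule v_sum_le) (simp_all add: near_1_power_le assms v_nonneg)
  then have "v (of_nat p + (\<Sum>i<p. u ^ i - 1)) \<le> max (1 / real p) (v (u - 1))"
    using v_ultra [of "of_nat p" "\<Sum>i<p. u ^ i - 1"] v_p by linarith
  moreover have "of_nat p + (\<Sum>i<p. u ^ i - 1) = (\<Sum>i<p. u ^ i)"
    by (simp add: sum_subtractf)
  ultimately show ?thesis
    by (simp add: power_diff_1_eq v_mult mult_left_mono v_nonneg)
qed

lemma p_gt_1: "p > 1"
  using prime_p by (rule prime_gt_1_nat)

lemma near_1_power_p_power_tendsto:
  assumes "v (1 - u) < 1"
  shows "(\<lambda>N. u ^ (p ^ N)) \<longlonglongrightarrow> 1"
proof -
  \<comment> \<open>One contraction factor serves every stage, since u^(p^N) is never farther from 1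
    than u.\<close>
  define c where "c = max (1 / real p) (v (u - 1))"
  have c: "0 \<le> c" "c < 1"
    using p_gt_1 assms v_diff_commute [of 1 u] by (auto simp: c_def le_max_iff_disj)
  have le: "v (u ^ (p ^ N) - 1) \<le> c ^ Suc N" for N
  proof (induction N)
    case 0
    then show ?case by (simp add: c_def)
  next
    case (Suc N)
    let ?x = "u ^ (p ^ N)"
    have "v (?x - 1) \<le> v (u - 1)"
      by (rule near_1_power_le [OF assms])
    then have x: "v (1 - ?x) < 1" "max (1 / real p) (v (?x - 1)) \<le> c"
      using assms v_diff_commute [of 1 u] v_diff_commute [of 1 ?x] by (auto simp: c_def)
    have "v (?x ^ p - 1) \<le> v (?x - 1) * c"
      using near_1_p_power_le [OF x(1)] mult_left_mono [OF x(2) v_nonneg] by (rule order_trans)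
    also have "\<dots> \<le> c ^ Suc N * c"
      using Suc c by (intro mult_right_mono)
    finally show ?case
      by (simp add: power_mult [symmetric] mult.commute)
  qed
  have "(\<lambda>N. c ^ Suc N) \<longlonglongrightarrow> 0"
    using c by (intro LIMSEQ_Suc LIMSEQ_realpow_zero)
  then have "(\<lambda>N. v (u ^ (p ^ N) - 1)) \<longlonglongrightarrow> 0"
    by (rule tendsto_sandwich [OF _ _ tendsto_const, rotated 2]) (simp_all only: le v_nonneg eventually_True)
  then show ?thesis
    by (simp only: v_tendsto_iff)
qed

lemma p_power_tendsto: "(\<lambda>N. of_nat (p ^ N)) \<longlonglongrightarrow> (0 :: 'a)"
proof -
  have "v (of_nat (p ^ N)) = (1 / real p) ^ N" for N
    by (induction N) (simp_all add: v_mult v_p)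
  then show ?thesis
    using p_gt_1 by (simp add: v_tendsto_iff LIMSEQ_realpow_zero del: of_nat_power)
qed

text \<open>Metric and field operations are linked only through \<open>v\<close>, so continuity of
  the product comes from XY = (X - L)(Y - M) + MX + LY - LM.\<close>

lemma v_tendsto_mult:
  fixes X Y :: "nat \<Rightarrow> 'a"
  assumes "X \<longlonglongrightarrow> L" "Y \<longlonglongrightarrow> M"
  shows "(\<lambda>n. X n * Y n) \<longlonglongrightarrow> L * M"
proof -
  have "(\<lambda>n. v (X n - L) * v (Y n - M)) \<longlonglongrightarrow> 0 * 0"
    using assms by (intro tendsto_mult) (simp_all add: v_tendsto_iff)
  then have "(\<lambda>n. (X n - L) * (Y n - M)) \<longlonglongrightarrow> 0"
    by (simp add: v_tendsto_iff v_mult)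
  from v_tendsto_add [OF this v_tendsto_add [OF v_tendsto_mult_left [OF assms(1), of M]
      v_tendsto_add [OF v_tendsto_mult_left [OF assms(2), of L] tendsto_const [of "- (L * M)"]]]]
  show ?thesis
    by (simp add: algebra_simps)
qed

lemma v_tendsto_power:
  fixes X :: "nat \<Rightarrow> 'a"
  assumes "X \<longlonglongrightarrow> L"
  shows "(\<lambda>n. X n ^ k) \<longlonglongrightarrow> L ^ k"
  by (induction k) (simp_all add: v_tendsto_mult assms)

text \<open>If u = -1, then 2 has absolute value below 1. With p = 2k + 1 so would 1 = p - 2k, a
  contradiction.\<close>

lemma near_1_plus_1_neq_0:
  assumes "odd p" "v (1 - u) < 1"
  shows "1 + u \<noteq> 0"
proof
  assume "1 + u = 0"
  then have "u = -1"
    by (simp add: eq_neg_iff_add_eq_0 add.commute)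
  then have v2: "v 2 < 1"
    using assms(2) by simp
  obtain k where k: "p = 2 * k + 1"
    using assms(1) by (elim oddE)
  have "v (2 * of_nat k) < 1"
    using v2 mult_left_le [OF v_of_nat_le_1 v_nonneg, of 2 k] by (simp add: v_mult)
  moreover have "v (of_nat p) < 1"
    using p_gt_1 by (simp add: v_p)
  moreover have "1 = of_nat p + - (2 * of_nat k :: 'a)"
    by (simp add: k)
  ultimately show False
    using v_ultra [of "of_nat p" "- (2 * of_nat k)"] by simp
qed

section \<open>Exponential polynomials\<close>

text \<open>The powers of m accommodate q = 1, where [m]_q = m.\<close>

inductive_set exp_polys :: "(nat \<Rightarrow> 'a) set" where
  monom: "v (1 - u) < 1 \<Longrightarrow> (\<lambda>m. u ^ m * of_nat m ^ k) \<in> exp_polys"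
| add: "f \<in> exp_polys \<Longrightarrow> g \<in> exp_polys \<Longrightarrow> (\<lambda>m. f m + g m) \<in> exp_polys"
| cmult: "f \<in> exp_polys \<Longrightarrow> (\<lambda>m. c * f m) \<in> exp_polys"

lemma exp_polys_zero: "(\<lambda>m. 0) \<in> exp_polys"
  using exp_polys.cmult [OF exp_polys.monom [of 1 0], of 0] by simp

lemma exp_polys_sum:
  assumes "\<And>i. i \<in> A \<Longrightarrow> f i \<in> exp_polys"
  shows "(\<lambda>m. \<Sum>i\<in>A. f i m) \<in> exp_polys"
  using assms
proof (induction A rule: infinite_finite_induct)
  case (insert i A)
  then show ?case by (simp add: exp_polys.add)
qed (simp_all add: exp_polys_zero)

lemma exp_polys_diff:
  assumes "f \<in> exp_polys" "g \<in> exp_polys"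
  shows "(\<lambda>m. f m - g m) \<in> exp_polys"
  using exp_polys.add [OF assms(1) exp_polys.cmult [OF assms(2), of "-1"]] by simp

lemma exp_polys_mult_power:
  assumes "g \<in> exp_polys" "v (1 - q) < 1"
  shows "(\<lambda>m. q ^ m * g m) \<in> exp_polys"
  using assms(1)
proof induction
  case (monom u k)
  then show ?case
    using exp_polys.monom [OF near_1_mult [OF assms(2)], of u k]
    by (simp add: power_mult_distrib mult.assoc)
next
  case (add f g)
  then show ?case using exp_polys.add by (simp add: distrib_left)
next
  case (cmult f c)
  then show ?case using exp_polys.cmult [of "\<lambda>m. q ^ m * f m" c] by (simp add: mult.left_commute)
qed

text \<open>These sequences are p-adically continuous: p^N tends to 0 and u^(p^N) to 1.\<close>

lemma exp_polys_tendsto: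
  assumes "g \<in> exp_polys"
  shows "(\<lambda>N. g (s + p ^ N)) \<longlonglongrightarrow> g s"
  using assms
proof induction
  case (monom u k)
  have "(\<lambda>N. u ^ s * u ^ (p ^ N)) \<longlonglongrightarrow> u ^ s * 1"
    by (intro v_tendsto_mult_left near_1_power_p_power_tendsto monom)
  moreover have "(\<lambda>N. (of_nat s + of_nat (p ^ N)) ^ k) \<longlonglongrightarrow> (of_nat s + 0 :: 'a) ^ k"
    by (intro v_tendsto_power v_tendsto_add tendsto_const p_power_tendsto)
  ultimately show ?case
    using v_tendsto_mult by (fastforce simp: power_add)
next
  case (add f g)
  then show ?case by (intro v_tendsto_add)
next
  case (cmult f c)
  then show ?case by (intro v_tendsto_mult_left)
qed

lemma exp_polys_rational_summable:
  assumes "odd p" "g \<in> exp_polys"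
  shows "\<exists>s. rational_sums (\<lambda>m. (-1) ^ m * g m) s"
  using assms(2)
proof induction
  case (monom u k)
  \<comment> \<open>The alternating series is geometric with ratio \<open>- u\<close>, so its pole
    is not at 1.\<close>
  then have "- u \<noteq> 1"
    using near_1_plus_1_neq_0 [OF assms(1)] by (metis add.right_inverse minus_minus add.commute)
  then show ?case
    using rational_summable_of_nat_power_mult [OF rational_sums_geometric, of "- u" k]
    by (simp add: power_minus [of u] mult_ac)
next
  case (add f g)
  then show ?case using rational_sums_add by (fastforce simp: distrib_left)
next
  case (cmult f c)
  then show ?case using rational_sums_cmult by (fastforce simp: mult.left_commute)
qed

text \<open>On the terms u^m m^k with u fixed, 1 + E is triangular in k with diagonal entry 1 + u,
  so it is inverted by induction on k.\<close>

lemma exp_polys_alternating_antidifference: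
  assumes "odd p" "g \<in> exp_polys"
  shows "\<exists>h\<in>exp_polys. \<forall>m. h m + h (Suc m) = 2 * g m"
  using assms(2)
proof induction
  case (monom u k)
  note u = near_1_plus_1_neq_0 [OF assms(1) monom]
  show ?case
  proof (induction k rule: less_induct)
    case (less k)
    then obtain h where h: "\<And>i. i < k \<Longrightarrow> h i \<in> exp_polys"
        "\<And>i m. i < k \<Longrightarrow> h i m + h i (Suc m) = 2 * (u ^ m * of_nat m ^ i)"
      by metis
    \<comment> \<open>The subtracted sum cancels the terms of degree i < k in the binomial expansion
      of u^(m+1) (m+1)^k; \<open>h i\<close> inverts each of them.\<close>
    define H where "H = (\<lambda>m. 1 / (1 + u) *
      (2 * (u ^ m * of_nat m ^ k) - (\<Sum>i<k. u * of_nat (k choose i) * h i m)))"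
    have "H \<in> exp_polys"
      unfolding H_def
      by (intro exp_polys.cmult exp_polys_diff exp_polys_sum exp_polys.monom monom h) simp
    moreover have "H m + H (Suc m) = 2 * (u ^ m * of_nat m ^ k)" for m
    proof -
      let ?S = "\<Sum>i<k. of_nat (k choose i) * of_nat m ^ i :: 'a"
      have "(of_nat m + 1) ^ k = (\<Sum>i\<le>k. of_nat (k choose i) * of_nat m ^ i :: 'a)"
        by (simp add: binomial_ring)
      then have S: "of_nat (Suc m) ^ k = ?S + of_nat m ^ k"
        by (simp add: lessThan_Suc_atMost [symmetric] add.commute)
      have "(\<Sum>i<k. u * of_nat (k choose i) * h i m) + (\<Sum>i<k. u * of_nat (k choose i) * h i (Suc m))
          = (\<Sum>i<k. u * of_nat (k choose i) * (h i m + h i (Suc m)))"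
        by (simp add: sum.distrib distrib_left)
      also have "\<dots> = 2 * u * u ^ m * ?S"
        by (simp add: h(2) sum_distrib_left mult_ac)
      finally have T: "(\<Sum>i<k. u * of_nat (k choose i) * h i m)
          = 2 * u * u ^ m * ?S - (\<Sum>i<k. u * of_nat (k choose i) * h i (Suc m))"
        by (simp add: eq_diff_eq)
      have "H j * (1 + u) = 2 * (u ^ j * of_nat j ^ k) - (\<Sum>i<k. u * of_nat (k choose i) * h i j)"
        for j
        using u by (simp add: H_def)
      then have "(H m + H (Suc m)) * (1 + u) = 2 * (u ^ m * of_nat m ^ k) * (1 + u)"
        by (simp only: distrib_right [of _ _ "1 + u"] T S) (simp add: algebra_simps)
      then show ?thesis
        using u by simp
    qed
    ultimately show ?case by blast
  qed
next
  case (add f g)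
  then obtain h k where "h \<in> exp_polys" "k \<in> exp_polys"
      "\<forall>m. h m + h (Suc m) = 2 * f m" "\<forall>m. k m + k (Suc m) = 2 * g m"
    by blast
  then show ?case
    by (intro bexI [OF _ exp_polys.add [of h k]]) (simp_all add: distrib_left, metis add.assoc add.left_commute)
next
  case (cmult f c)
  then obtain h where "h \<in> exp_polys" "\<forall>m. h m + h (Suc m) = 2 * f m"
    by blast
  then show ?case
    by (intro bexI [OF _ exp_polys.cmult [of h c]]) (simp_all add: distrib_left [symmetric])
qed

section \<open>Iterated integrals of exponential polynomials\<close>

text \<open>The fermionic limit samples only natural numbers, so sequences suffice. The offset
  \<open>s\<close> holds the sum of the other variables, which turns iterated integration into a
  power of one operator.\<close>

definition fermionic_op :: "(nat \<Rightarrow> 'a) \<Rightarrow> nat \<Rightarrow> 'a" where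
  "fermionic_op g s = lim (\<lambda>N. \<Sum>x<p ^ N. g (s + x) * (-1) ^ x)"

lemma alternating_sum_telescope:
  fixes g h :: "nat \<Rightarrow> 'a"
  assumes "\<And>m. h m + h (Suc m) = 2 * g m"
  shows "2 * (\<Sum>x<M. g (s + x) * (-1) ^ x) = h s - (-1) ^ M * h (s + M)"
proof (induction M)
  case (Suc M)
  then show ?case
    using assms [of "s + M"]
    by (simp add: distrib_left mult.assoc [symmetric] flip: assms) (simp add: algebra_simps)
qed simp

text \<open>Solutions of the recurrence differ by multiples of (-1)^m. Membership in
  \<open>exp_polys\<close> gives the continuity that singles out the integral.\<close>

lemma fermionic_op_eq:
  assumes "odd p" "h \<in> exp_polys" "\<And>m. h m + h (Suc m) = 2 * g m"
  shows "fermionic_op g = h"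
proof
  fix s
  \<comment> \<open>\<open>p ^ N\<close> is odd, so the boundary term enters with a plus
    sign.\<close>
  have "(\<Sum>x<p ^ N. g (s + x) * (-1) ^ x) = 1 / 2 * (h s + h (s + p ^ N))" for N
    using alternating_sum_telescope [where h = h and g = g and s = s and M = "p ^ N"] assms(1,3)
    by (simp add: field_simps)
  moreover have "(\<lambda>N. 1 / 2 * (h s + h (s + p ^ N))) \<longlonglongrightarrow> 1 / 2 * (h s + h s)"
    by (intro v_tendsto_mult_left v_tendsto_add tendsto_const exp_polys_tendsto assms)
  ultimately show "fermionic_op g s = h s"
    unfolding fermionic_op_def by (simp only:) (simp add: limI)
qed

lemma
  assumes "odd p" "g \<in> exp_polys"
  shows fermionic_op_exp_polys: "fermionic_op g \<in> exp_polys"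
    and fermionic_op_add_Suc: "fermionic_op g m + fermionic_op g (Suc m) = 2 * g m"
proof -
  obtain h where h: "h \<in> exp_polys" "\<And>m. h m + h (Suc m) = 2 * g m"
    using exp_polys_alternating_antidifference [OF assms] by blast
  then have "fermionic_op g = h"
    by (rule fermionic_op_eq [OF assms(1)])
  then show "fermionic_op g \<in> exp_polys" "fermionic_op g m + fermionic_op g (Suc m) = 2 * g m"
    using h by simp_all
qed

text \<open>The integrand depends only on the sum of the variables, so fixing the outer variable x
  just moves the offset from s to s + x.\<close>

lemma iterated_fermionic_integral_eq:
  assumes "\<And>ns. f (map of_nat ns) = g (s + sum_list ns)"
  shows "iterated_fermionic_integral p r f = (fermionic_op ^^ r) g s"
  using assms
proof (induction r arbitrary: f s)
  case 0
  then show ?case using 0 [of "[]"] by simp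
next
  case (Suc r)
  have "iterated_fermionic_integral p r (\<lambda>xs. f (of_nat x # xs)) = (fermionic_op ^^ r) g (s + x)"
    for x
    by (rule Suc.IH) (use Suc.prems [of "x # _"] in \<open>simp add: add.assoc\<close>)
  then show ?case
    by (simp add: fermionic_integral_def fermionic_op_def [of "(fermionic_op ^^ r) g"])
qed

text \<open>There are r + 1 integrations here, so the weight (m + r choose m) matches the usual one
  without subtraction.\<close>

lemma rational_sums_fermionic_op:
  assumes "odd p" "g \<in> exp_polys"
  shows "rational_sums (\<lambda>m. of_nat ((m + r) choose m) * (-1) ^ m * g m)
           ((fermionic_op ^^ Suc r) g 0 / 2 ^ Suc r)"
  using assms(2)
proof (induction r arbitrary: g)
  case 0
  define h where "h = fermionic_op g"
  have h: "h \<in> exp_polys" "\<And>m. h m + h (Suc m) = 2 * g m"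
    using fermionic_op_exp_polys fermionic_op_add_Suc assms(1) 0 by (simp_all add: h_def)
  obtain s where s: "rational_sums (\<lambda>m. (-1) ^ m * h m) s"
    using exp_polys_rational_summable [OF assms(1) h(1)] by blast
  have "g m = 1 / 2 * (h m + h (Suc m))" for m
    using h(2) [of m] by simp
  \<comment> \<open>The series is half the difference between the series of (-1)^m h m and its
    shift, so only h 0 / 2 remains.\<close>
  then have "of_nat ((m + 0) choose m) * (-1) ^ m * g m
      = 1 / 2 * ((-1) ^ m * h m - (-1) ^ Suc m * h (Suc m))" for m
    by (simp add: algebra_simps)
  then show ?case
    using rational_sums_cmult [OF rational_sums_diff [OF s rational_sums_Suc [OF s]], of "1 / 2"]
    by (simp only:) (simp add: h_def)
next
  case (Suc r)
  define h where "h = fermionic_op g"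
  have h: "h \<in> exp_polys" "\<And>m. h m + h (Suc m) = 2 * g m"
    using fermionic_op_exp_polys fermionic_op_add_Suc assms(1) Suc.prems by (simp_all add: h_def)
  define a where "a = (\<lambda>k m. of_nat ((m + k) choose m) * (-1) ^ m * h m)"
  define s where "s = (fermionic_op ^^ Suc r) h 0 / 2 ^ Suc r"
  have s: "rational_sums (a r) s"
    unfolding a_def s_def by (rule Suc.IH [OF h(1)])
  \<comment> \<open>Only the existence of this sum matters: its value cancels below as d - (d - s) =
    s.\<close>
  obtain d where d: "rational_sums (a (Suc r)) d"
    using exp_polys_rational_summable [OF assms(1) h(1)] rational_summable_binomial_mult
    unfolding a_def mult.assoc by blast
  \<comment> \<open>Pascal's rule, with the sign coming from (-1)^(m+1).\<close>
  have "a (Suc r) (Suc m) - a r (Suc m)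
      = - (of_nat ((m + Suc r) choose m) * (-1) ^ m * h (Suc m))" for m
    by (simp add: a_def algebra_simps)
  \<comment> \<open>The zeroth term vanishes, so the shift leaves the sum d - s unchanged.\<close>
  moreover have "a (Suc r) 0 - a r 0 = 0"
    by (simp add: a_def)
  ultimately have "rational_sums
      (\<lambda>m. - (of_nat ((m + Suc r) choose m) * (-1) ^ m * h (Suc m))) (d - s)"
    using rational_sums_Suc [OF rational_sums_diff [OF d s]] by simp
  from rational_sums_cmult [OF rational_sums_diff [OF d this], of "1 / 2"]
  have "rational_sums (\<lambda>m. 1 / 2 * (of_nat ((m + Suc r) choose m) * (-1) ^ m * (h m + h (Suc m))))
      (1 / 2 * s)"
    by (simp add: a_def distrib_left)
  moreover have "1 / 2 * s = (fermionic_op ^^ Suc (Suc r)) g 0 / 2 ^ Suc (Suc r)"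
    by (simp add: s_def h_def funpow_swap1)
  moreover have "1 / 2 * (of_nat ((m + Suc r) choose m) * (-1) ^ m * (h m + h (Suc m)))
      = of_nat ((m + Suc r) choose m) * (-1) ^ m * g m" for m
    unfolding h(2) by simp
  ultimately show ?case
    by (simp only:)
qed

section \<open>The integrand of the q-Euler numbers\<close>

lemma exp_polys_q_number_power:
  assumes "v (1 - q) < 1" "v (1 - w) < 1"
  shows "(\<lambda>m. w ^ m * q_number q (of_nat m) ^ n) \<in> exp_polys"
proof (cases "q = 1")
  case True
  then show ?thesis by (simp add: q_number_def exp_polys.monom assms)
next
  case False
  show ?thesis
  proof (induction n)
    case 0
    then show ?case using exp_polys.monom [OF assms(2), of 0] by simp
  next
    case (Suc n)
    \<comment> \<open>For q different from 1, multiplication by [m]_q sends g to (g - q^m g) / (1 -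
      q), which stays in the space.\<close>
    then have "(\<lambda>m. 1 / (1 - q) * (w ^ m * q_number q (of_nat m) ^ n
        - q ^ m * (w ^ m * q_number q (of_nat m) ^ n))) \<in> exp_polys"
      using exp_polys.cmult [OF exp_polys_diff [OF _ exp_polys_mult_power [OF _ assms(1)]]] by blast
    moreover have "1 / (1 - q) * (w ^ m * q_number q (of_nat m) ^ n
        - q ^ m * (w ^ m * q_number q (of_nat m) ^ n)) = w ^ m * q_number q (of_nat m) ^ Suc n" for m
    proof -
      have "q_number q (of_nat m) = 1 / (1 - q) * (1 - q ^ m)"
        using False by (simp add: q_number_def padic_power_of_nat)
      then show ?thesis
        by (simp add: diff_divide_distrib [symmetric] left_diff_distrib right_diff_distrib mult_ac)
    qed
    ultimately show ?case by simp
  qed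
qed

end

theorem theorem1:
  fixes p r n :: nat
    and v :: "'a::{field_char_0, complete_space} \<Rightarrow> real"
    and q w :: 'a
  assumes "padic_complex_field p v"
    and "odd p"
    and "v (1 - q) < 1"
    and "v (1 - w) < 1"
    and "r \<ge> 1"
  shows "\<exists>S. rational_sums
              (\<lambda>m. of_nat ((m + r - 1) choose m) * (-1) ^ m * w ^ m * q_number q (of_nat m) ^ n) S
           \<and> q_euler_number p r n w q = 2 ^ r * S"
proof -
  interpret padic_complex_field p v by fact
  define g where "g = (\<lambda>m. w ^ m * q_number q (of_nat m) ^ n)"
  have g: "g \<in> exp_polys"
    unfolding g_def by (rule exp_polys_q_number_power [OF assms(3,4)])
  \<comment> \<open>Since r is positive, the truncated \<open>m + r - 1\<close> is exactly m +
    k.\<close>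
  obtain k where r: "r = Suc k"
    using assms(5) by (cases r) auto
  have sum: "sum_list (map of_nat ns) = (of_nat (sum_list ns) :: 'a)" for ns
    by (induction ns) simp_all
  have "q_euler_number p r n w q = (fermionic_op ^^ r) g 0"
    unfolding q_euler_number_def
    by (rule iterated_fermionic_integral_eq) (simp only: sum padic_power_of_nat g_def add_0)
  moreover have "rational_sums (\<lambda>m. of_nat ((m + r - 1) choose m) * (-1) ^ m * w ^ m
      * q_number q (of_nat m) ^ n) ((fermionic_op ^^ r) g 0 / 2 ^ r)"
    using rational_sums_fermionic_op [OF assms(2) g, of k] by (simp add: r g_def mult.assoc)
  ultimately show ?thesis
    by (intro exI conjI) (assumption, simp)
qed

end
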